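(* Let $\mathcal P$ be a nontrivial symmetric system of pairs with parameters $(v,n,t)$ on the set $V=\{1,2,\dots,v\}$. 1. Let $x,y\in V$ be fixed distinct elements. There are precisely $2t-1$ subsystems of $\mathcal P$ each of which contains both $x$ and $y$ as elements of some pairs. 2. For $v\neq 4$, there exists a simple block design $\mathcal D_2(\mathcal P)$ with parameters $$v_2=v,\quad b_2=\frac n3\binom t2,\quad r_2=\frac13(v-1)(t-1),\quad k_2=4,\quad \lambda_2=t-1 .$$ 3. If $\mathcal P$ is simple, then for any integer $q$ with $2<q\leqslant t$ and $v\neq 2q$ there exists a simple block design $\mathcal D_q(\mathcal P)$ with parameters $$v_q=v,\quad b_q=n\binom tq,\quad r_q=(v-1)\binom{t-1}{q-1},\quad k_q=2q,\quad \lambda_q=(2q-1)\binom{t-1}{q-1}.$$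
   Context: A block design with parameters $(v,b,r,k,\lambda)$ (with $b,r,k,\lambda$ positive integers and $k<v$) on a finite set $V$ with $|V|=v$ is a collection of $b$ blocks, each a $k$-element subset of $V$, such that every element of $V$ lies in exactly $r$ blocks and every pair of distinct elements of $V$ is contained in exactly $\lambda$ blocks. It is called simple if it has no repeated blocks. A system of pairs $\mathcal P$ with parameters $(v,n,t)$ on $V=\{1,\dots,v\}$ is an arrangement (partition) of all $\frac{v(v-1)}2$ unordered pairs of distinct elements of $V$ into $n$ families $\mathcal P_1,\dots,\mathcal P_n$ (called subsystems) of $t$ pairs each, for some integers $n,t\geqslant 1$ with $nt=\frac{v(v-1)}2$, such that no subsystem contains any element of $V$ more than once (i.e. the pairs in a subsystem are pairwise disjoint). It is trivial if $t=1$, nontrivial otherwise. A system of pairs $\mathcal P$ is symmetric if for any two distinct unordered pairs $\{x,y\}$ and $\{\alpha,\beta\}$ belonging to the same subsystem $\mathcal P_l$ there exist subsystems $\mathcal P_i$ and $\mathcal P_j$ such that $\mathcal P_i$ contains $\{x,\alpha\}$ and $\{y,\beta\}$, and $\mathcal P_j$ contains $\{x,\beta\}$ and $\{y,\alpha\}$. Order the pairs in each subsystem from $1$ to $t$ and write $\mathcal P_j(i)$ for the $i$th pair of $\mathcal P_j$; for $s\subseteq\{1,\dots,t\}$ put $f_j(s)=\bigcup_{m\in s}\mathcal P_j(m)\subseteq V$. A nontrivial symmetric system of pairs is called simple if for every integer $q$ with $2<q\leqslant t$, all $q$-element subsets $s_1,s_2$ of $\{1,\dots,t\}$ and all $j_1,j_2\in\{1,\dots,n\}$,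 one has $f_{j_1}(s_1)=f_{j_2}(s_2)$ if and only if $j_1=j_2$ and $s_1=s_2$. *)

theory Defs
  imports Complex_Main "HOL-Library.Multiset" "HOL-Library.Disjoint_Sets"
begin

text \<open>Blocks may be repeated in a general design, so the blocks form a multiset.\<close>

definition block_design ::
    "'a set \<Rightarrow> nat \<Rightarrow> nat \<Rightarrow> nat \<Rightarrow> nat \<Rightarrow> nat \<Rightarrow> 'a set multiset \<Rightarrow> bool" where
  "block_design V v b r k lam D \<longleftrightarrow>
     finite V \<and> card V = v \<and>
     0 < b \<and> 0 < r \<and> 0 < k \<and> 0 < lam \<and> k < v \<and>
     size D = b \<and>
     (\<forall>B. B \<in># D \<longrightarrow> B \<subseteq> V \<and> card B = k) \<and>
     (\<forall>x\<in>V. size {#B \<in># D. x \<in> B#} = r) \<and>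
     (\<forall>x\<in>V. \<forall>y\<in>V. x \<noteq> y \<longrightarrow> size {#B \<in># D. x \<in> B \<and> y \<in> B#} = lam)"

definition simple_blocks :: "'a set multiset \<Rightarrow> bool" where
  "simple_blocks D \<longleftrightarrow> (\<forall>B. count D B \<le> 1)"

definition unordered_pairs :: "'a set \<Rightarrow> 'a set set" where
  "unordered_pairs V = {p. p \<subseteq> V \<and> card p = 2}"

text \<open>The subsystems are \<open>P 1, \<dots>, P n\<close>; values of \<open>P\<close> at other indices are irrelevant.\<close>

definition system_of_pairs :: "nat \<Rightarrow> nat \<Rightarrow> nat \<Rightarrow> (nat \<Rightarrow> nat set set) \<Rightarrow> bool" where
  "system_of_pairs v n t P \<longleftrightarrow>
     1 \<le> n \<and> 1 \<le> t \<and> n * t = v * (v - 1) div 2 \<and>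
     (\<Union>j\<in>{1..n}. P j) = unordered_pairs {1..v} \<and>
     disjoint_family_on P {1..n} \<and>
     (\<forall>j\<in>{1..n}. card (P j) = t \<and> disjoint (P j))"

definition symmetric_system :: "nat \<Rightarrow> (nat \<Rightarrow> nat set set) \<Rightarrow> bool" where
  "symmetric_system n P \<longleftrightarrow>
     (\<forall>l\<in>{1..n}. \<forall>x y \<alpha> \<beta>.
        {x, y} \<in> P l \<and> {\<alpha>, \<beta>} \<in> P l \<and> {x, y} \<noteq> {\<alpha>, \<beta>} \<longrightarrow>
          (\<exists>i\<in>{1..n}. {x, \<alpha>} \<in> P i \<and> {y, \<beta>} \<in> P i) \<and>
          (\<exists>j\<in>{1..n}. {x, \<beta>} \<in> P j \<and> {y, \<alpha>} \<in> P j))"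

definition nontrivial_symmetric_system ::
    "nat \<Rightarrow> nat \<Rightarrow> nat \<Rightarrow> (nat \<Rightarrow> nat set set) \<Rightarrow> bool" where
  "nontrivial_symmetric_system v n t P \<longleftrightarrow>
     system_of_pairs v n t P \<and> t \<noteq> 1 \<and> symmetric_system n P"

definition pair_ordering ::
    "nat \<Rightarrow> nat \<Rightarrow> (nat \<Rightarrow> nat set set) \<Rightarrow> (nat \<Rightarrow> nat \<Rightarrow> nat set) \<Rightarrow> bool" where
  "pair_ordering n t P e \<longleftrightarrow> (\<forall>j\<in>{1..n}. bij_betw (e j) {1..t} (P j))"

definition selected_union :: "(nat \<Rightarrow> nat \<Rightarrow> nat set) \<Rightarrow> nat \<Rightarrow> nat set \<Rightarrow> nat set" where
  "selected_union e j s = (\<Union>m\<in>s. e j m)"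

text \<open>
  Simplicity does not depend on the ordering: for equal indices the stated equivalence always
  holds, because the pairs in a subsystem are disjoint and nonempty, and for distinct indices
  it ranges over all \<open>q\<close>-element subfamilies of both subsystems. Hence requiring it for some
  ordering is the same as requiring it for every ordering.
\<close>

definition simple_system :: "nat \<Rightarrow> nat \<Rightarrow> nat \<Rightarrow> (nat \<Rightarrow> nat set set) \<Rightarrow> bool" where
  "simple_system v n t P \<longleftrightarrow>
     nontrivial_symmetric_system v n t P \<and>
     (\<exists>e. pair_ordering n t P e \<and>
        (\<forall>q s1 s2 j1 j2.
           2 < q \<and> q \<le> t \<and>
           s1 \<subseteq> {1..t} \<and> card s1 = q \<and> s2 \<subseteq> {1..t} \<and> card s2 = q \<and>
           j1 \<in> {1..n} \<and> j2 \<in> {1..n} \<longrightarrow>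
             (selected_union e j1 s1 = selected_union e j2 s2 \<longleftrightarrow> j1 = j2 \<and> s1 = s2)))"

end

theory Submission
  imports Defs
begin

text \<open>
  If \<open>x\<close> and \<open>y\<close> both occur in a subsystem, in distinct pairs \<open>{x, a}\<close> and \<open>{y, b}\<close>, then by symmetry
  \<open>{a, b}\<close> lies in the subsystem of \<open>{x, y}\<close>; so the subsystems covering \<open>x\<close> and \<open>y\<close> correspond to
  the possible partners \<open>a\<close> of \<open>x\<close>, which range over the \<open>2t - 1\<close> elements other than \<open>x\<close> covered
  by the subsystem of \<open>{x, y}\<close>. The blocks of the designs are the unions of \<open>q\<close> pairs of a
  common subsystem. It suffices to determine \<open>\<lambda>\<close>, as double counting then gives
  \<open>r (k - 1) = (v - 1) \<lambda>\<close> and \<open>b k = v r\<close>. For \<open>q = 2\<close> symmetry shows that every block through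
  \<open>x, y\<close> arises from \<open>{x, y}\<close> and another pair of its subsystem; for \<open>q > 2\<close> one sums over
  the \<open>2t - 1\<close> subsystems covering \<open>x\<close> and \<open>y\<close>.
\<close>

section \<open>Counting tools for designs and for subsets\<close>

lemma block_design_of_pair_count:
  assumes fin: "finite V" and D: "\<And>B. B \<in> D \<Longrightarrow> B \<subseteq> V \<and> card B = k"
    and k: "2 \<le> k" "k < card V" and lam: "0 < lam"
    and pairs: "\<And>x y. x \<in> V \<Longrightarrow> y \<in> V \<Longrightarrow> x \<noteq> y \<Longrightarrow> card {B \<in> D. x \<in> B \<and> y \<in> B} = lam"
  obtains b r where "r * (k - 1) = (card V - 1) * lam" "b * k = card V * r"
    "block_design V (card V) b r k lam (mset_set D)" "simple_blocks (mset_set D)"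
proof -
  have finD: "finite D"
    using finite_subset[of D "Pow V"] D fin by blast
  have deg: "card {B \<in> D. x \<in> B} * (k - 1) = (card V - 1) * lam" if x: "x \<in> V" for x
  proof -
    \<comment> \<open>Double count of the incidences \<open>(y, B)\<close> with
      \<open>y \<noteq> x\<close> and \<open>x\<close>, \<open>y\<close> both in
      \<open>B\<close>.\<close>
    have "(\<Sum>B\<in>{B \<in> D. x \<in> B}. card {y \<in> V - {x}. y \<in> B}) = lam * card (V - {x})"
    proof (rule sum_multicount)
      show "\<forall>y\<in>V - {x}. card {B \<in> {B \<in> D. x \<in> B}. y \<in> B} = lam"
        using pairs x by (auto simp: conj_ac)
    qed (use fin finD in auto)
    moreover have "card {y \<in> V - {x}. y \<in> B} = k - 1" if "B \<in> {B \<in> D. x \<in> B}" for B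
    proof -
      have "{y \<in> V - {x}. y \<in> B} = B - {x}" using D that by auto
      then show ?thesis using D that by simp
    qed
    ultimately show ?thesis using x by simp
  qed
  obtain x0 where x0: "x0 \<in> V" using k by fastforce
  define r where "r = card {B \<in> D. x0 \<in> B}"
  \<comment> \<open>The value of \<open>deg\<close> does not depend on \<open>x\<close>, and the
    factor \<open>k - 1\<close> is nonzero, so it cancels.\<close>
  have r: "card {B \<in> D. x \<in> B} = r" if "x \<in> V" for x
    using deg[OF that] deg[OF x0] k unfolding r_def
    by (metis mult_right_cancel diff_is_0_eq not_less_eq_eq one_add_one plus_1_eq_Suc)
  have "(\<Sum>B\<in>D. card {x \<in> V. x \<in> B}) = r * card V"
    by (rule sum_multicount) (use fin finD r in auto)
  moreover have "card {x \<in> V. x \<in> B} = k" if "B \<in> D" for B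
    using D[OF that] by (metis Collect_conj_eq Collect_mem_eq inf.absorb_iff2)
  ultimately have b: "card D * k = card V * r"
    by (simp add: mult.commute)
  have rk: "r * (k - 1) = (card V - 1) * lam"
    using deg[OF x0] r_def by simp
  have "r * (k - 1) > 0" using rk k lam by simp
  then have rpos: "0 < r" by simp
  then have "card D * k > 0" using b k by simp
  then have bpos: "0 < card D" by simp
  have "block_design V (card V) (card D) r k lam (mset_set D)"
    unfolding block_design_def
    using fin finD D k lam rpos bpos r pairs by (simp add: filter_mset_mset_set)
  moreover have "simple_blocks (mset_set D)"
    by (simp add: simple_blocks_def count_mset_set')
  ultimately show thesis using that rk b by blast
qed

text \<open>Deleting \<open>S\<close> from \<open>Q\<close> leaves an arbitrary subset of
  \<open>A - S\<close> of size \<open>q - card S\<close>. Below, \<open>A\<close> is a subsystem and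
  \<open>S\<close> consists of the one or two pairs that cover \<open>x\<close> and
  \<open>y\<close>.\<close>

lemma card_subsets_containing:
  assumes "finite A" "S \<subseteq> A" "card S \<le> q"
  shows "card {Q. Q \<subseteq> A \<and> card Q = q \<and> S \<subseteq> Q} = (card A - card S) choose (q - card S)"
proof -
  have fS: "finite S" using assms finite_subset by blast
  have "bij_betw (\<lambda>R. R \<union> S) {R. R \<subseteq> A - S \<and> card R = q - card S}
          {Q. Q \<subseteq> A \<and> card Q = q \<and> S \<subseteq> Q}"
  proof (rule bij_betw_byWitness[where f' = "\<lambda>Q. Q - S"])
    show "(\<lambda>R. R \<union> S) ` {R. R \<subseteq> A - S \<and> card R = q - card S}
        \<subseteq> {Q. Q \<subseteq> A \<and> card Q = q \<and> S \<subseteq> Q}"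
    proof clarsimp
      fix R assume "R \<subseteq> A - S" "card R = q - card S"
      moreover have "finite R" using \<open>R \<subseteq> A - S\<close> assms(1) by (meson finite_Diff finite_subset)
      moreover have "R \<inter> S = {}" using \<open>R \<subseteq> A - S\<close> by blast
      ultimately show "R \<subseteq> A \<and> S \<subseteq> A \<and> card (R \<union> S) = q"
        using assms fS by (auto simp: card_Un_disjoint)
    qed
    show "(\<lambda>Q. Q - S) ` {Q. Q \<subseteq> A \<and> card Q = q \<and> S \<subseteq> Q}
        \<subseteq> {R. R \<subseteq> A - S \<and> card R = q - card S}"
      using card_Diff_subset[OF fS] by blast
  qed blast+
  then have "card {Q. Q \<subseteq> A \<and> card Q = q \<and> S \<subseteq> Q}
      = card {R. R \<subseteq> A - S \<and> card R = q - card S}"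
    by (rule bij_betw_same_card[symmetric])
  also have "\<dots> = card (A - S) choose (q - card S)"
    using assms by (simp add: n_subsets)
  also have "card (A - S) = card A - card S"
    using assms fS by (simp add: card_Diff_subset)
  finally show ?thesis .
qed

section \<open>Basic facts on symmetric systems of pairs\<close>

locale sym_pairs =
  fixes v n t :: nat and P :: "nat \<Rightarrow> nat set set"
  assumes sys: "nontrivial_symmetric_system v n t P"
begin

lemma t_ge_2: "2 \<le> t" and pair_number: "2 * (n * t) = v * (v - 1)"
  and card_subsystem: "j \<in> {1..n} \<Longrightarrow> card (P j) = t"
  and disjoint_subsystem: "j \<in> {1..n} \<Longrightarrow> disjoint (P j)"
  and Union_subsystems: "(\<Union>j\<in>{1..n}. P j) = unordered_pairs {1..v}"
  and disjoint_family: "disjoint_family_on P {1..n}"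
  and symmetric: "symmetric_system n P"
proof -
  have sp: "system_of_pairs v n t P" "t \<noteq> 1" and symm: "symmetric_system n P"
    using sys unfolding nontrivial_symmetric_system_def by auto
  \<comment> \<open>Evenness makes the truncating division in \<open>system_of_pairs\<close>
    exact.\<close>
  have "even (v * (v - 1))" by (cases v) auto
  then show "2 * (n * t) = v * (v - 1)"
    using sp by (simp add: system_of_pairs_def)
  show "2 \<le> t" using sp unfolding system_of_pairs_def by auto
  show "(\<Union>j\<in>{1..n}. P j) = unordered_pairs {1..v}" "disjoint_family_on P {1..n}"
    using sp unfolding system_of_pairs_def by auto
  show "card (P j) = t" "disjoint (P j)" if "j \<in> {1..n}" for j
    using sp that unfolding system_of_pairs_def by auto
  show "symmetric_system n P" by (fact symm)
qed

lemma finite_subsystem: "j \<in> {1..n} \<Longrightarrow> finite (P j)"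
  \<comment> \<open>An infinite set would have \<open>card\<close> equal to 0, against
    \<open>2 \<le> t\<close>.\<close>
  using card_subsystem t_ge_2 by (metis card.infinite not_numeral_le_zero)

lemma pairD: "j \<in> {1..n} \<Longrightarrow> p \<in> P j \<Longrightarrow> p \<subseteq> {1..v} \<and> card p = 2"
  using Union_subsystems unfolding unordered_pairs_def by blast

lemma pair_with:
  assumes "j \<in> {1..n}" "p \<in> P j" "x \<in> p"
  obtains a where "p = {x, a}" "x \<noteq> a" "x \<in> {1..v}" "a \<in> {1..v}"
proof -
  have p: "p \<subseteq> {1..v}" "card p = 2" using pairD assms by auto
  then obtain a b where ab: "p = {a, b}" "a \<noteq> b" by (meson card_2_iff)
  then show thesis using that[of a] that[of b] p assms(3) by auto
qed

lemma subsystem_of_pair: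
  assumes "x \<in> {1..v}" "y \<in> {1..v}" "x \<noteq> y"
  obtains l where "l \<in> {1..n}" "{x, y} \<in> P l"
proof -
  have "{x, y} \<in> unordered_pairs {1..v}" using assms by (simp add: unordered_pairs_def)
  then show thesis using that Union_subsystems by blast
qed

lemma subsystem_unique:
  assumes "i \<in> {1..n}" "j \<in> {1..n}" "p \<in> P i" "p \<in> P j"
  shows "i = j"
  using disjoint_family assms unfolding disjoint_family_on_def by blast

lemma pair_unique:
  assumes "j \<in> {1..n}" "p \<in> P j" "p' \<in> P j" "x \<in> p" "x \<in> p'"
  shows "p = p'"
  using disjoint_subsystem[OF assms(1)] assms unfolding disjoint_def by blast

text \<open>One half of the symmetry condition is enough: exchanging \<open>a\<close> and
  \<open>b\<close> yields the other half.\<close>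

lemma symD:
  assumes "l \<in> {1..n}" "{x, y} \<in> P l" "{a, b} \<in> P l" "{x, y} \<noteq> {a, b}"
  obtains i where "i \<in> {1..n}" "{x, a} \<in> P i" "{y, b} \<in> P i"
proof -
  have "\<exists>i\<in>{1..n}. {x, a} \<in> P i \<and> {y, b} \<in> P i"
    using symmetric assms unfolding symmetric_system_def by blast
  then show thesis using that by blast
qed

lemma card_Union_pairs:
  assumes "j \<in> {1..n}" "Q \<subseteq> P j"
  shows "card (\<Union>Q) = 2 * card Q"
proof -
  have "card (\<Union>Q) = (\<Sum>p\<in>Q. card p)"
  proof (rule card_Union_disjoint)
    show "disjoint Q" using disjoint_subsystem[OF assms(1)] assms(2) by (auto simp: disjoint_def)
    show "finite p" if "p \<in> Q" for p
      using pairD[of j p] assms that by (auto intro: finite_subset)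
  qed
  also have "\<dots> = (\<Sum>p\<in>Q. 2)" using pairD assms by (intro sum.cong) auto
  finally show ?thesis by simp
qed

lemma Union_pairs_subset: "j \<in> {1..n} \<Longrightarrow> Q \<subseteq> P j \<Longrightarrow> \<Union>Q \<subseteq> {1..v}"
  using pairD by blast

section \<open>Subsystems covering two given elements\<close>

definition covering :: "nat \<Rightarrow> nat \<Rightarrow> nat set" where
  "covering x y = {j \<in> {1..n}. (\<exists>p\<in>P j. x \<in> p) \<and> (\<exists>p\<in>P j. y \<in> p)}"

text \<open>Sending \<open>a\<close> to the subsystem of \<open>{x, a}\<close> is a bijection from
  the elements of \<open>\<Union>(P l)\<close> other than \<open>x\<close> onto the covering
  subsystems; the element \<open>y\<close> corresponds to \<open>l\<close> itself.\<close>

lemma card_covering: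
  assumes xy: "x \<in> {1..v}" "y \<in> {1..v}" "x \<noteq> y"
  shows "card (covering x y) = 2 * t - 1"
proof -
  obtain l where l: "l \<in> {1..n}" "{x, y} \<in> P l" using subsystem_of_pair xy by blast
  let ?A = "\<Union>(P l) - {x}"
  have ex: "\<exists>j. j \<in> covering x y \<and> {x, a} \<in> P j" if "a \<in> ?A" for a
  proof (cases "a = y")
    case True
    then show ?thesis using l unfolding covering_def by blast
  next
    case False
    from that obtain p where p: "p \<in> P l" "a \<in> p" "a \<noteq> x" by blast
    obtain b where b: "p = {a, b}" using pair_with[OF l(1) p(1,2)] by blast
    have "{x, y} \<noteq> {a, b}" using False p by auto
    then obtain i where "i \<in> {1..n}" "{x, a} \<in> P i" "{y, b} \<in> P i"
      using symD[OF l, of a b] p b by blast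
    then show ?thesis unfolding covering_def by blast
  qed
  \<comment> \<open>The choice is harmless, since \<open>{x, a}\<close> lies in only one
    subsystem.\<close>
  define g where "g a = (SOME j. j \<in> covering x y \<and> {x, a} \<in> P j)" for a
  have g: "g a \<in> covering x y" "{x, a} \<in> P (g a)" if "a \<in> ?A" for a
    using someI_ex[OF ex[OF that]] unfolding g_def by auto
  have "bij_betw g ?A (covering x y)"
  proof (rule bij_betw_imageI)
    show "inj_on g ?A"
    proof (rule inj_onI)
      fix a b assume ab: "a \<in> ?A" "b \<in> ?A" "g a = g b"
      have "g a \<in> {1..n}" using g(1)[OF ab(1)] unfolding covering_def by simp
      then have "{x, a} = {x, b}"
        by (rule pair_unique[where x = x]) (use g(2)[OF ab(1)] g(2)[OF ab(2)] ab(3) in simp_all)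
      then show "a = b" using ab by (auto simp: doubleton_eq_iff)
    qed
    show "g ` ?A = covering x y"
    proof
      show "g ` ?A \<subseteq> covering x y" using g by blast
      show "covering x y \<subseteq> g ` ?A"
      proof
        fix j assume "j \<in> covering x y"
        then obtain p p' where j: "j \<in> {1..n}" and p: "p \<in> P j" "x \<in> p" "p' \<in> P j" "y \<in> p'"
          unfolding covering_def by blast
        obtain a where a: "p = {x, a}" "x \<noteq> a" using pair_with[OF j p(1,2)] by metis
        obtain b where b: "p' = {y, b}" "y \<noteq> b" using pair_with[OF j p(3,4)] by metis
        have aA: "a \<in> ?A"
        proof (cases "p = p'")
          case True
          then have "a = y" using a b xy by auto
          then show ?thesis using l xy by auto
        next
          case False
          \<comment> \<open>Symmetry is now used in the reverse direction: from
            \<open>{x, a}\<close> and \<open>{y, b}\<close> in \<open>P j\<close> back to the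
            subsystem of \<open>{x, y}\<close>, which therefore covers \<open>a\<close>.\<close>
          then obtain i where i: "i \<in> {1..n}" "{x, y} \<in> P i" "{a, b} \<in> P i"
            using symD[OF j, of x a y b] p a b by auto
          then have "i = l" using subsystem_unique l by blast
          then show ?thesis using i a by auto
        qed
        moreover have "g a \<in> {1..n}" using g(1)[OF aA] unfolding covering_def by simp
        then have "j = g a" using subsystem_unique[of j "g a" "{x, a}"] j p a g(2)[OF aA] by blast
        ultimately show "j \<in> g ` ?A" by blast
      qed
    qed
  qed
  then have "card (covering x y) = card ?A" by (simp add: bij_betw_same_card)
  also have "x \<in> \<Union>(P l)" using l by blast
  then have "card ?A = card (\<Union>(P l)) - 1" by (simp add: card_Diff_singleton)
  also have "card (\<Union>(P l)) = 2 * t"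
    using card_Union_pairs[OF l(1) order_refl] card_subsystem[OF l(1)] by simp
  finally show ?thesis .
qed

text \<open>The \<open>t\<close> disjoint pairs of one subsystem cover \<open>2 * t\<close>
  elements, so \<open>2 * q \<le> 2 * t \<le> v\<close>. This supplies the condition
  \<open>k < v\<close> of a design.\<close>

lemma twice_less_v:
  assumes "v \<noteq> 2 * q" "q \<le> t"
  shows "2 * q < v"
proof -
  have "0 < n" using sys unfolding nontrivial_symmetric_system_def system_of_pairs_def by simp
  then have "1 \<in> {1..n}" by simp
  then have "card (\<Union>(P 1)) = 2 * t" "\<Union>(P 1) \<subseteq> {1..v}"
    using card_Union_pairs[of 1 "P 1"] card_subsystem[of 1] Union_pairs_subset[of 1 "P 1"] by simp_all
  then have "2 * t \<le> v" using card_mono[of "{1..v}" "\<Union>(P 1)"] by simp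
  then show ?thesis using assms by linarith
qed

section \<open>Blocks as unions of pairs, and the blocks through two elements\<close>

definition subfamilies :: "nat \<Rightarrow> nat set set set" where
  "subfamilies q = {Q. \<exists>j\<in>{1..n}. Q \<subseteq> P j \<and> card Q = q}"

text \<open>Taking a set of unions merges repetitions. For \<open>q = 2\<close> symmetry makes each
  block arise from all three of its splittings into two pairs, whence the factor one third in the
  second design.\<close>

definition blocks :: "nat \<Rightarrow> nat set set" where
  "blocks q = Union ` subfamilies q"

lemma blockD: "B \<in> blocks q \<Longrightarrow> B \<subseteq> {1..v} \<and> card B = 2 * q"
  unfolding blocks_def subfamilies_def using card_Union_pairs Union_pairs_subset by blast

lemma card_blocks_two_through_pair:
  assumes xy: "x \<in> {1..v}" "y \<in> {1..v}" "x \<noteq> y"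
  shows "card {B \<in> blocks 2. x \<in> B \<and> y \<in> B} = t - 1"
proof -
  obtain l where l: "l \<in> {1..n}" "{x, y} \<in> P l" using subsystem_of_pair xy by blast
  let ?R = "P l - {{x, y}}"
  have disj: "p \<inter> {x, y} = {}" if "p \<in> ?R" for p
    using that disjoint_subsystem[OF l(1)] l(2) by (auto dest: disjointD)
  have "{B \<in> blocks 2. x \<in> B \<and> y \<in> B} = (\<lambda>p. p \<union> {x, y}) ` ?R"
  proof
    show "(\<lambda>p. p \<union> {x, y}) ` ?R \<subseteq> {B \<in> blocks 2. x \<in> B \<and> y \<in> B}"
    proof
      fix B assume "B \<in> (\<lambda>p. p \<union> {x, y}) ` ?R"
      then obtain p where p: "p \<in> ?R" "B = p \<union> {x, y}" by blast
      then have "{p, {x, y}} \<in> subfamilies 2"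
        using l unfolding subfamilies_def by auto
      moreover have "B = \<Union>{p, {x, y}}" using p by simp
      ultimately show "B \<in> {B \<in> blocks 2. x \<in> B \<and> y \<in> B}"
        unfolding blocks_def using p by blast
    qed
    show "{B \<in> blocks 2. x \<in> B \<and> y \<in> B} \<subseteq> (\<lambda>p. p \<union> {x, y}) ` ?R"
    proof
      fix B assume "B \<in> {B \<in> blocks 2. x \<in> B \<and> y \<in> B}"
      then obtain Q j where Q: "j \<in> {1..n}" "Q \<subseteq> P j" "card Q = 2"
        and B: "B = \<Union>Q" "x \<in> B" "y \<in> B"
        unfolding blocks_def subfamilies_def by blast
      from B obtain p where p: "p \<in> Q" "x \<in> p" by blast
      obtain p' where p': "Q = {p, p'}" "p \<noteq> p'" using Q(3) p(1) by (auto simp: card_2_iff)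
      have pP: "p \<in> P j" "p' \<in> P j" using Q p' by auto
      obtain a where a: "p = {x, a}" using pair_with[OF Q(1) pP(1) p(2)] by metis
      show "B \<in> (\<lambda>p. p \<union> {x, y}) ` ?R"
      proof (cases "y \<in> p")
        case True
        then have pxy: "p = {x, y}" using a xy by auto
        then have "j = l" using subsystem_unique l Q pP by blast
        then have "p' \<in> ?R" "B = p' \<union> {x, y}" using pP p' pxy B by auto
        then show ?thesis by blast
      next
        \<comment> \<open>Here \<open>x\<close> and \<open>y\<close> lie in different pairs
          \<open>{x, a}\<close> and \<open>{y, b}\<close>; symmetry regroups the same block as
          \<open>{x, y}\<close> and \<open>{a, b}\<close>.\<close>
        case False
        then have "y \<in> p'" using B p' by blast
        then obtain b where b: "p' = {y, b}" using pair_with[OF Q(1) pP(2)] by metis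
        obtain i where i: "i \<in> {1..n}" "{x, y} \<in> P i" "{a, b} \<in> P i"
          using symD[OF Q(1), of x a y b] pP a b p' by auto
        then have "i = l" using subsystem_unique l by blast
        \<comment> \<open>This ensures that \<open>{a, b}\<close> is not the removed pair
          \<open>{x, y}\<close>.\<close>
        moreover have "x \<notin> {a, b}"
          using pair_unique[OF Q(1) pP p(2)] p' pairD[OF Q(1) pP(1)] a b by force
        ultimately have "{a, b} \<in> ?R" using i by auto
        moreover have "B = {a, b} \<union> {x, y}" using B p' a b by auto
        ultimately show ?thesis by blast
      qed
    qed
  qed
  moreover have "inj_on (\<lambda>p. p \<union> {x, y}) ?R"
  proof (rule inj_onI)
    fix p p' assume "p \<in> ?R" "p' \<in> ?R" "p \<union> {x, y} = p' \<union> {x, y}"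
    then show "p = p'" using disj[of p] disj[of p'] by blast
  qed
  ultimately show ?thesis
    using card_image l card_subsystem[OF l(1)] by (simp add: card_image)
qed

text \<open>In \<open>l\<close> the single pair \<open>{x, y}\<close> must be chosen; in each of the
  other \<open>2 * t - 2\<close> covering subsystems two distinct pairs are forced. Subfamilies are
  counted here, not their unions.\<close>

lemma card_subfamilies_through_pair:
  assumes xy: "x \<in> {1..v}" "y \<in> {1..v}" "x \<noteq> y" and q: "2 \<le> q"
  shows "card {Q \<in> subfamilies q. x \<in> \<Union>Q \<and> y \<in> \<Union>Q} = (2 * q - 1) * ((t - 1) choose (q - 1))"
proof -
  obtain l where l: "l \<in> {1..n}" "{x, y} \<in> P l" using subsystem_of_pair xy by blast
  define F where "F j = {Q. Q \<subseteq> P j \<and> card Q = q \<and> x \<in> \<Union>Q \<and> y \<in> \<Union>Q}" for j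
  have finc: "finite (covering x y)" unfolding covering_def by simp
  have lc: "l \<in> covering x y" using l unfolding covering_def by blast
  have "{Q \<in> subfamilies q. x \<in> \<Union>Q \<and> y \<in> \<Union>Q} = (\<Union>j\<in>covering x y. F j)"
    unfolding subfamilies_def F_def covering_def by blast
  also have "card \<dots> = (\<Sum>j\<in>covering x y. card (F j))"
  proof (rule card_UN_disjoint[OF finc])
    show "\<forall>j\<in>covering x y. finite (F j)"
    proof
      fix j assume "j \<in> covering x y"
      then have "finite (P j)" using finite_subsystem unfolding covering_def by simp
      then show "finite (F j)" unfolding F_def by simp
    qed
    show "\<forall>i\<in>covering x y. \<forall>j\<in>covering x y. i \<noteq> j \<longrightarrow> F i \<inter> F j = {}"
    proof (intro ballI impI, rule ccontr)
      \<comment> \<open>A common member has \<open>x\<close> in its union, so it is nonempty and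
        provides a pair shared by both subsystems.\<close>
      fix i j assume ij: "i \<in> covering x y" "j \<in> covering x y" "i \<noteq> j" "F i \<inter> F j \<noteq> {}"
      then obtain p where "p \<in> P i" "p \<in> P j" unfolding F_def by blast
      then show False using subsystem_unique[of i j p] ij unfolding covering_def by blast
    qed
  qed
  also have "\<dots> = card (F l) + (\<Sum>j\<in>covering x y - {l}. card (F j))"
    using finc lc by (simp add: sum.remove)
  also have "card (F l) = (t - 1) choose (q - 1)"
  proof -
    have "F l = {Q. Q \<subseteq> P l \<and> card Q = q \<and> {{x, y}} \<subseteq> Q}"
    proof -
      have "{x, y} \<in> Q" if "Q \<subseteq> P l" "x \<in> \<Union>Q" for Q
        using that pair_unique[OF l(1) l(2)] by auto
      then show ?thesis unfolding F_def by auto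
    qed
    then show ?thesis
      using card_subsets_containing[of "P l" "{{x, y}}" q] l q finite_subsystem card_subsystem by simp
  qed
  also have "(\<Sum>j\<in>covering x y - {l}. card (F j))
      = (\<Sum>j\<in>covering x y - {l}. (t - 2) choose (q - 2))"
  proof (rule sum.cong)
    fix j assume j: "j \<in> covering x y - {l}"
    then have jn: "j \<in> {1..n}" unfolding covering_def by simp
    obtain p p' where p: "p \<in> P j" "x \<in> p" "p' \<in> P j" "y \<in> p'"
      using j unfolding covering_def by blast
    have "p \<noteq> p'"
    proof
      assume "p = p'"
      then have "p = {x, y}" using pair_with[OF jn p(1,2)] p xy by (metis insertE singletonD)
      then show False using subsystem_unique[OF jn l(1)] l p j by blast
    qed
    have "F j = {Q. Q \<subseteq> P j \<and> card Q = q \<and> {p, p'} \<subseteq> Q}"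
    proof -
      have "p \<in> Q \<and> p' \<in> Q" if "Q \<subseteq> P j" "x \<in> \<Union>Q" "y \<in> \<Union>Q" for Q
        using that pair_unique[OF jn] p by (metis UnionE subsetD)
      then show ?thesis using p unfolding F_def by auto
    qed
    then show "card (F j) = (t - 2) choose (q - 2)"
      using card_subsets_containing[of "P j" "{p, p'}" q] \<open>p \<noteq> p'\<close> p q jn
        finite_subsystem card_subsystem by (simp add: numeral_2_eq_2)
  qed simp
  also have "\<dots> = 2 * ((t - 1) * ((t - 2) choose (q - 2)))"
  proof -
    have "card (covering x y - {l}) = 2 * (t - 1)"
      using card_covering[OF xy] lc by (simp add: card_Diff_singleton)
    then show ?thesis by simp
  qed
  \<comment> \<open>Absorption identity for binomial coefficients; it gives both contributions a
    common factor.\<close>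
  also have "(t - 1) * ((t - 2) choose (q - 2)) = (q - 1) * ((t - 1) choose (q - 1))"
    using Suc_times_binomial_eq[of "t - 2" "q - 2"] t_ge_2 q
    by (simp add: Suc_diff_Suc numeral_2_eq_2 mult.commute)
  finally have "card {Q \<in> subfamilies q. x \<in> \<Union>Q \<and> y \<in> \<Union>Q}
      = (1 + 2 * (q - 1)) * ((t - 1) choose (q - 1))"
    by (simp only: distrib_right mult_1 mult.assoc)
  also have "1 + 2 * (q - 1) = 2 * q - 1" using q by simp
  finally show ?thesis .
qed

text \<open>Simplicity speaks of index sets; the ordering \<open>e\<close> turns every subfamily
  into the image of such a set, so equal unions force equal indices.\<close>

lemma inj_on_Union_subfamilies:
  assumes "simple_system v n t P" and q: "2 < q" "q \<le> t"
  shows "inj_on Union (subfamilies q)"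
proof (rule inj_onI)
  from assms(1) obtain e where ord: "pair_ordering n t P e"
    and eq_iff: "\<forall>q s1 s2 j1 j2.
           2 < q \<and> q \<le> t \<and>
           s1 \<subseteq> {1..t} \<and> card s1 = q \<and> s2 \<subseteq> {1..t} \<and> card s2 = q \<and>
           j1 \<in> {1..n} \<and> j2 \<in> {1..n} \<longrightarrow>
             (selected_union e j1 s1 = selected_union e j2 s2 \<longleftrightarrow> j1 = j2 \<and> s1 = s2)"
    unfolding simple_system_def by auto
  have e: "bij_betw (e j) {1..t} (P j)" if "j \<in> {1..n}" for j
    using ord that unfolding pair_ordering_def by blast
  have simple: "\<And>s1 s2 j1 j2. s1 \<subseteq> {1..t} \<Longrightarrow> card s1 = q \<Longrightarrow> s2 \<subseteq> {1..t} \<Longrightarrow> card s2 = q \<Longrightarrow>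
        j1 \<in> {1..n} \<Longrightarrow> j2 \<in> {1..n} \<Longrightarrow>
        selected_union e j1 s1 = selected_union e j2 s2 \<Longrightarrow> j1 = j2 \<and> s1 = s2"
    using eq_iff[rule_format, of q] q by blast
  have indices: "\<exists>j s. j \<in> {1..n} \<and> s \<subseteq> {1..t} \<and> card s = q \<and> Q = e j ` s"
    if Q: "Q \<in> subfamilies q" for Q
  proof -
    obtain j where j: "j \<in> {1..n}" "Q \<subseteq> P j" "card Q = q"
      using Q unfolding subfamilies_def by blast
    then have "Q \<subseteq> e j ` {1..t}" using e[OF j(1)] by (simp add: bij_betw_def)
    then obtain s where s: "s \<subseteq> {1..t}" "Q = e j ` s" by (meson subset_imageE)
    have "inj_on (e j) s" using e[OF j(1)] s by (meson bij_betw_def inj_on_subset)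
    then show ?thesis using s j card_image by metis
  qed
  fix Q1 Q2 assume Q: "Q1 \<in> subfamilies q" "Q2 \<in> subfamilies q" and eq: "\<Union>Q1 = \<Union>Q2"
  obtain j1 s1 where 1: "j1 \<in> {1..n}" "s1 \<subseteq> {1..t}" "card s1 = q" "Q1 = e j1 ` s1"
    using indices[OF Q(1)] by blast
  obtain j2 s2 where 2: "j2 \<in> {1..n}" "s2 \<subseteq> {1..t}" "card s2 = q" "Q2 = e j2 ` s2"
    using indices[OF Q(2)] by blast
  have "selected_union e j1 s1 = selected_union e j2 s2"
    using eq 1 2 by (simp add: selected_union_def)
  then show "Q1 = Q2" using simple 1 2 by blast
qed

text \<open>For a simple system \<open>Union\<close> is injective on subfamilies, so their count
  carries over to blocks.\<close>

lemma card_blocks_through_pair: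
  assumes "simple_system v n t P" "2 < q" "q \<le> t" "x \<in> {1..v}" "y \<in> {1..v}" "x \<noteq> y"
  shows "card {B \<in> blocks q. x \<in> B \<and> y \<in> B} = (2 * q - 1) * ((t - 1) choose (q - 1))"
proof -
  let ?S = "{Q \<in> subfamilies q. x \<in> \<Union>Q \<and> y \<in> \<Union>Q}"
  have "{B \<in> blocks q. x \<in> B \<and> y \<in> B} = Union ` ?S" unfolding blocks_def by blast
  moreover have "inj_on Union ?S"
    using inj_on_Union_subfamilies assms by (auto intro: inj_on_subset)
  ultimately show ?thesis
    using card_subfamilies_through_pair assms by (simp add: card_image)
qed

section \<open>Parameters of the two kinds of designs\<close>

lemma design_two:
  assumes "v \<noteq> 4"
  shows "\<exists>b r. \<exists>D :: nat set multiset.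
           real b = real n / 3 * real (t choose 2) \<and>
           real r = 1 / 3 * (real v - 1) * (real t - 1) \<and>
           block_design {1..v} v b r 4 (t - 1) D \<and> simple_blocks D"
proof -
  have v: "4 < v" using twice_less_v[of 2] assms t_ge_2 by simp
  obtain b r where br: "r * (4 - 1) = (card {1..v} - 1) * (t - 1)" "b * 4 = card {1..v} * r"
    and des: "block_design {1..v} (card {1..v}) b r 4 (t - 1) (mset_set (blocks 2))"
      "simple_blocks (mset_set (blocks 2))"
    by (rule block_design_of_pair_count[of "{1..v}" "blocks 2" 4 "t - 1"])
      (use v t_ge_2 blockD[of _ 2] card_blocks_two_through_pair in auto)
  have "real (r * 3) = real ((v - 1) * (t - 1))" using br(1) by simp
  then have r: "real r * 3 = (real v - 1) * (real t - 1)"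
    using v t_ge_2 by (simp add: of_nat_diff)
  have "real (2 * (n * t)) = real (v * (v - 1))" using pair_number by simp
  then have nt: "2 * (real n * real t) = real v * (real v - 1)" using v by (simp add: of_nat_diff)
  have b: "real b * 4 = real v * real r"
    using arg_cong[OF br(2), of real] by simp
  \<comment> \<open>Substituting \<open>r\<close> and then the number of pairs eliminates
    \<open>v\<close>. The computation is carried out in the reals because the target formulas
    contain thirds.\<close>
  have "real b * 12 = real v * (real r * 3)" using b by linarith
  also have "\<dots> = 2 * (real n * real t) * (real t - 1)" unfolding r nt by simp
  finally have "real b * 6 = real n * (real t * (real t - 1))" by simp
  moreover have "real t * (real t - 1) = 2 * real (t choose 2)"
    by (simp add: binomial_gbinomial gbinomial_prod_rev numeral_2_eq_2)
  ultimately have "real b * 6 = real n * (2 * real (t choose 2))" by simp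
  then have "real b = real n / 3 * real (t choose 2)" by simp
  then show ?thesis using r des by (intro exI[of _ b] exI[of _ r] exI[of _ "mset_set (blocks 2)"]) simp
qed

lemma design_of_simple:
  assumes simple: "simple_system v n t P" and q: "2 < q" "q \<le> t" and "v \<noteq> 2 * q"
  shows "\<exists>D :: nat set multiset.
              block_design {1..v} v
                (n * (t choose q)) ((v - 1) * ((t - 1) choose (q - 1)))
                (2 * q) ((2 * q - 1) * ((t - 1) choose (q - 1))) D \<and>
              simple_blocks D"
proof -
  let ?c = "(t - 1) choose (q - 1)"
  have v: "2 * q < v" using twice_less_v assms by blast
  \<comment> \<open>By \<open>q \<le> t\<close> the binomial coefficient is nonzero, so
    \<open>lam\<close> is positive.\<close>
  have c: "0 < ?c" using q by simp
  obtain b r where br: "r * (2 * q - 1) = (card {1..v} - 1) * ((2 * q - 1) * ?c)"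
      "b * (2 * q) = card {1..v} * r"
    and des: "block_design {1..v} (card {1..v}) b r (2 * q) ((2 * q - 1) * ?c) (mset_set (blocks q))"
      "simple_blocks (mset_set (blocks q))"
    by (rule block_design_of_pair_count[of "{1..v}" "blocks q" "2 * q" "(2 * q - 1) * ?c"])
      (use v q c blockD[of _ q] card_blocks_through_pair[OF simple q] in auto)
  have "r * (2 * q - 1) = ((v - 1) * ?c) * (2 * q - 1)" using br(1) by (simp add: ac_simps)
  then have r: "r = (v - 1) * ?c" using q by simp
  \<comment> \<open>Absorption again; combined with \<open>v * (v - 1) = 2 * (n * t)\<close> it
    converts \<open>v * r\<close> into the required multiple of \<open>t choose q\<close>.\<close>
  have "t * ?c = q * (t choose q)"
    using Suc_times_binomial_eq[of "t - 1" "q - 1"] q by (simp add: mult.commute)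
  moreover have "b * (2 * q) = 2 * (n * t) * ?c"
    using br(2) r unfolding pair_number by simp
  ultimately have "b * (2 * q) = (n * (t choose q)) * (2 * q)" by auto
  then have "b = n * (t choose q)" using q by simp
  then show ?thesis using des r by auto
qed

end

theorem theorem2:
  fixes v n t :: nat and P :: "nat \<Rightarrow> nat set set"
  assumes "nontrivial_symmetric_system v n t P"
  shows
    "(\<forall>x\<in>{1..v}. \<forall>y\<in>{1..v}. x \<noteq> y \<longrightarrow>
        card {j \<in> {1..n}. (\<exists>p\<in>P j. x \<in> p) \<and> (\<exists>p\<in>P j. y \<in> p)} = 2 * t - 1)
     \<and> (v \<noteq> 4 \<longrightarrow>
        (\<exists>b r. \<exists>D :: nat set multiset.
           real b = real n / 3 * real (t choose 2) \<and>
           real r = 1 / 3 * (real v - 1) * (real t - 1) \<and>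
           block_design {1..v} v b r 4 (t - 1) D \<and> simple_blocks D))
     \<and> (simple_system v n t P \<longrightarrow>
        (\<forall>q. 2 < q \<and> q \<le> t \<and> v \<noteq> 2 * q \<longrightarrow>
           (\<exists>D :: nat set multiset.
              block_design {1..v} v
                (n * (t choose q)) ((v - 1) * ((t - 1) choose (q - 1)))
                (2 * q) ((2 * q - 1) * ((t - 1) choose (q - 1))) D \<and>
              simple_blocks D)))"
proof -
  interpret sym_pairs v n t P using assms by unfold_locales
  show ?thesis
    using card_covering design_two design_of_simple unfolding covering_def by blast
qed

end
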